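(* Let $R$ be an s-unital ring and $I$ an s-unital (two-sided) ideal of $R$. Assume that every nonzero ideal in every quotient of $I$ contains a nonzero idempotent. Then $R$ is properly purely infinite if and only if $I$ and $R/I$ are both properly purely infinite.
   Context: Rings are associative and not necessarily unital. A ring $R$ is s-unital if for each $x\in R$ there exist $u,v\in R$ with $ux=xv=x$. An ideal $I$ is s-unital if it is s-unital when viewed as a ring in its own right (so $u,v$ must lie in $I$). "Quotient of $I$" and "$I$ is properly purely infinite" refer to $I$ as a ring. An element $a$ of a ring $R$ is properly infinite if $a\neq 0$ and there exist $\alpha_1,\alpha_2,\beta_1,\beta_2\in R$ with $\alpha_i a\beta_j=\delta_{ij}a$ for all $i,j\in\{1,2\}$. A ring is properly purely infinite if every nonzero element of it is properly infinite. *)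

theory Defs
  imports "HOL-Algebra.QuotRing"
begin

text \<open>
  Rings need not have an identity. They are represented by the record type of HOL-Algebra, whose
  field \<open>one\<close> is left unconstrained and does not enter the definitions. In particular
  \<open>R\<lparr>carrier := I\<rparr>\<close> is the ideal \<open>I\<close> regarded as a ring, and \<open>R Quot I\<close>
  has the expected carrier, addition, zero and multiplication.
\<close>

locale nonunital_ring = abelian_group R for R (structure) +
  assumes m_closed [intro, simp]: "\<lbrakk>x \<in> carrier R; y \<in> carrier R\<rbrakk> \<Longrightarrow> x \<otimes> y \<in> carrier R"
    and m_assoc: "\<lbrakk>x \<in> carrier R; y \<in> carrier R; z \<in> carrier R\<rbrakk>
      \<Longrightarrow> (x \<otimes> y) \<otimes> z = x \<otimes> (y \<otimes> z)"
    and l_distr: "\<lbrakk>x \<in> carrier R; y \<in> carrier R; z \<in> carrier R\<rbrakk>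
      \<Longrightarrow> (x \<oplus> y) \<otimes> z = x \<otimes> z \<oplus> y \<otimes> z"
    and r_distr: "\<lbrakk>x \<in> carrier R; y \<in> carrier R; z \<in> carrier R\<rbrakk>
      \<Longrightarrow> z \<otimes> (x \<oplus> y) = z \<otimes> x \<oplus> z \<otimes> y"

text \<open>The library locale \<^locale>\<open>ideal\<close> demands that the ambient ring be unital.\<close>

locale nonunital_ideal = nonunital_ring R + additive_subgroup I R for I and R (structure) +
  assumes I_l_closed: "\<lbrakk>a \<in> I; x \<in> carrier R\<rbrakk> \<Longrightarrow> x \<otimes> a \<in> I"
    and I_r_closed: "\<lbrakk>a \<in> I; x \<in> carrier R\<rbrakk> \<Longrightarrow> a \<otimes> x \<in> I"

locale s_unital_ring = nonunital_ring R for R (structure) +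
  assumes s_unital: "x \<in> carrier R
      \<Longrightarrow> \<exists>u \<in> carrier R. \<exists>v \<in> carrier R. u \<otimes> x = x \<and> x \<otimes> v = x"

definition properly_infinite :: "('a, 'b) ring_scheme \<Rightarrow> 'a \<Rightarrow> bool" where
  "properly_infinite R a \<longleftrightarrow> a \<in> carrier R \<and> a \<noteq> \<zero>\<^bsub>R\<^esub> \<and>
     (\<exists>\<alpha>\<^sub>1 \<in> carrier R. \<exists>\<alpha>\<^sub>2 \<in> carrier R. \<exists>\<beta>\<^sub>1 \<in> carrier R. \<exists>\<beta>\<^sub>2 \<in> carrier R.
        \<alpha>\<^sub>1 \<otimes>\<^bsub>R\<^esub> a \<otimes>\<^bsub>R\<^esub> \<beta>\<^sub>1 = a \<and> \<alpha>\<^sub>1 \<otimes>\<^bsub>R\<^esub> a \<otimes>\<^bsub>R\<^esub> \<beta>\<^sub>2 = \<zero>\<^bsub>R\<^esub> \<and>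
        \<alpha>\<^sub>2 \<otimes>\<^bsub>R\<^esub> a \<otimes>\<^bsub>R\<^esub> \<beta>\<^sub>1 = \<zero>\<^bsub>R\<^esub> \<and> \<alpha>\<^sub>2 \<otimes>\<^bsub>R\<^esub> a \<otimes>\<^bsub>R\<^esub> \<beta>\<^sub>2 = a)"

definition properly_purely_infinite :: "('a, 'b) ring_scheme \<Rightarrow> bool" where
  "properly_purely_infinite R \<longleftrightarrow>
     (\<forall>a \<in> carrier R. a \<noteq> \<zero>\<^bsub>R\<^esub> \<longrightarrow> properly_infinite R a)"

definition idempotents :: "('a, 'b) ring_scheme \<Rightarrow> 'a set" where
  "idempotents R = {e \<in> carrier R. e \<otimes>\<^bsub>R\<^esub> e = e}"

lemma nonunital_ideal_iff_ideal:
  assumes "ring R"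
  shows "nonunital_ideal I R \<longleftrightarrow> ideal I R"
proof -
  interpret ring R by fact
  have "nonunital_ring R"
    by unfold_locales (auto simp: m_assoc l_distr r_distr)
  then show ?thesis
    using assms
    by (auto simp: nonunital_ideal_def nonunital_ideal_axioms_def ideal_def ideal_axioms_def
        additive_subgroup_def)
qed

lemma (in nonunital_ideal) ideal_is_ring: "nonunital_ring (R\<lparr>carrier := I\<rparr>)"
proof -
  have comm: "comm_group (add_monoid (R\<lparr>carrier := I\<rparr>))"
    using subgroup.subgroup_is_group[OF a_subgroup comm_group.axioms(2)[OF a_comm_group]]
    by (auto intro!: group.group_comm_groupI simp: a_comm)
  show ?thesis
    apply (intro nonunital_ring.intro abelian_group.intro abelian_monoid.intro
        abelian_group_axioms.intro nonunital_ring_axioms.intro)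
    using comm by (auto simp: comm_group_def I_l_closed m_assoc l_distr r_distr)
qed

lemma (in nonunital_ideal) rcoset_mult_add:
  assumes "x \<in> carrier R" "y \<in> carrier R"
  shows "[mod I:] (I +> x) \<Otimes> (I +> y) = I +> (x \<otimes> y)"
proof -
  have ag: "abelian_subgroup I R"
    by (rule abelian_subgroupI3) unfold_locales
  have cong: "I +> x' \<otimes> y' = I +> x \<otimes> y" if "x' \<in> I +> x" "y' \<in> I +> y" for x' y'
  proof -
    from that obtain h k where hk: "h \<in> I" "k \<in> I" "x' = h \<oplus> x" "y' = k \<oplus> y"
      by (auto simp: a_r_coset_def')
    note carr = assms hk(1,2)[THEN a_Hcarr]
    have "x' \<otimes> y' = (h \<otimes> (k \<oplus> y) \<oplus> x \<otimes> k) \<oplus> x \<otimes> y"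
      using carr by (simp add: hk l_distr r_distr a_ac)
    moreover have "h \<otimes> (k \<oplus> y) \<oplus> x \<otimes> k \<in> I"
      using carr hk by (simp add: I_l_closed I_r_closed)
    ultimately have "x' \<otimes> y' \<in> I +> x \<otimes> y"
      by (auto simp: a_r_coset_def')
    then show ?thesis
      using a_repr_independence[OF _ _ a_subgroup] assms by (metis m_closed)
  qed
  have "x \<in> I +> x" "y \<in> I +> y"
    using abelian_subgroup.a_rcos_self[OF ag] assms by auto
  then show ?thesis
    unfolding rcoset_mult_def using cong by blast
qed

lemma (in nonunital_ideal) quotient_is_ring: "nonunital_ring (R Quot I)"
proof -
  have ag: "abelian_subgroup I R"
    by (rule abelian_subgroupI3) unfold_locales
  have comm: "comm_group (add_monoid (R Quot I))"
    using abelian_subgroup.a_factorgroup_is_comm_group[OF ag]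
    by (simp add: A_FactGroup_def' FactRing_def)
  have sum: "(I +> x) <+> (I +> y) = I +> (x \<oplus> y)" if "x \<in> carrier R" "y \<in> carrier R" for x y
    using abelian_subgroup.a_rcos_sum[OF ag] that .
  show ?thesis
    apply (intro nonunital_ring.intro abelian_group.intro abelian_monoid.intro
        abelian_group_axioms.intro nonunital_ring_axioms.intro)
    using comm
    by (auto simp: comm_group_def FactRing_simps rcoset_mult_add sum m_assoc l_distr r_distr)
qed

end

theory Submission
  imports Defs
begin

text \<open>
  The forward implication is a matter of moving witnesses: they pass to cosets, and for \<open>x \<in> I\<close>
  they are brought into \<open>I\<close> by multiplying with local units of \<open>x\<close> taken from \<open>I\<close>.

  For the converse, fix \<open>a \<noteq> \<zero>\<close> and say that a \<open>2 \<times> 2\<close> matrix lies below \<open>a\<close> if its entries are the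
  products \<open>\<alpha>\<^sub>i \<otimes> a \<otimes> \<beta>\<^sub>j\<close> for suitable \<open>\<alpha>\<^sub>i\<close>, \<open>\<beta>\<^sub>j\<close>. The \<open>x\<close> for which \<open>diag(a, x)\<close> lies below \<open>a\<close> are
  the elements that \<open>a\<close> absorbs; call the set of them \<open>K\<close>. Then \<open>a\<close> is properly infinite iff
  \<open>a \<in> K\<close>. Since \<open>diag(a, k)\<close> lies below \<open>a\<close> for \<open>k \<in> K\<close>, there is always room for a second summand: adding
  \<open>k\<close> to an entry of a matrix below \<open>a\<close> gives another matrix below \<open>a\<close>
  (\<open>matrix_below_add_absorbed\<close>). Hence \<open>K\<close> is an ideal, and \<open>2 \<times> 2\<close> matrices that lie below \<open>a\<close> modulo
  \<open>K\<close> lie below \<open>a\<close> in \<open>R\<close>. So no element outside \<open>K\<close> becomes absorbed by \<open>a\<close> on passing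
  to \<open>R Quot K\<close> (\<open>absorbed_quot_lift\<close>).

  Suppose that \<open>a\<close> is properly infinite modulo \<open>I\<close>. The equations \<open>\<alpha>\<^sub>i \<otimes> a \<otimes> \<beta>\<^sub>j = \<delta>\<^sub>i\<^sub>j a\<close> then hold up to
  errors in \<open>I\<close>. If \<open>I a I \<subseteq> K\<close>, local units of the errors show that the errors lie in \<open>K\<close>,
  and they can be removed (\<open>properly_infinite_mod_ideal\<close>). Otherwise there is
  \<open>x = r \<otimes> a \<otimes> s \<in> I - K\<close> with \<open>r, s \<in> I\<close>. As \<open>x\<close> is properly infinite in \<open>I\<close>, the products
  \<open>p \<otimes> x \<otimes> q\<close> with \<open>p, q \<in> I\<close> form an ideal of \<open>I\<close>, and the hypothesis on the quotient of \<open>I\<close> by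
  \<open>I \<inter> K\<close> makes one of these products, \<open>f\<close>, a nonzero idempotent modulo \<open>K\<close>. Its class is again
  of the form \<open>r \<otimes> a \<otimes> s\<close>, which splits \<open>a\<close> modulo \<open>K\<close> into a summand equivalent to \<open>f\<close> and a
  complement. Since \<open>f\<close> is properly infinite, doubling that summand shows that \<open>a\<close> absorbs
  \<open>f\<close> modulo \<open>K\<close> (\<open>properly_infinite_idempotent_absorbed\<close>). By lifting, \<open>f \<in> K\<close>, a contradiction.
\<close>

section \<open>Matrices below an element\<close>

definition matrix_below ::
    "('a, 'b) ring_scheme \<Rightarrow> 'a \<Rightarrow> 'a \<Rightarrow> 'a \<Rightarrow> 'a \<Rightarrow> 'a \<Rightarrow> bool" where
  "matrix_below R a m\<^sub>1\<^sub>1 m\<^sub>1\<^sub>2 m\<^sub>2\<^sub>1 m\<^sub>2\<^sub>2 \<longleftrightarrow>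
     (\<exists>\<alpha>\<^sub>1 \<in> carrier R. \<exists>\<alpha>\<^sub>2 \<in> carrier R. \<exists>\<beta>\<^sub>1 \<in> carrier R. \<exists>\<beta>\<^sub>2 \<in> carrier R.
        \<alpha>\<^sub>1 \<otimes>\<^bsub>R\<^esub> a \<otimes>\<^bsub>R\<^esub> \<beta>\<^sub>1 = m\<^sub>1\<^sub>1 \<and> \<alpha>\<^sub>1 \<otimes>\<^bsub>R\<^esub> a \<otimes>\<^bsub>R\<^esub> \<beta>\<^sub>2 = m\<^sub>1\<^sub>2 \<and>
        \<alpha>\<^sub>2 \<otimes>\<^bsub>R\<^esub> a \<otimes>\<^bsub>R\<^esub> \<beta>\<^sub>1 = m\<^sub>2\<^sub>1 \<and> \<alpha>\<^sub>2 \<otimes>\<^bsub>R\<^esub> a \<otimes>\<^bsub>R\<^esub> \<beta>\<^sub>2 = m\<^sub>2\<^sub>2)"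

definition absorbed :: "('a, 'b) ring_scheme \<Rightarrow> 'a \<Rightarrow> 'a set" where
  "absorbed R a = {x \<in> carrier R. matrix_below R a a \<zero>\<^bsub>R\<^esub> \<zero>\<^bsub>R\<^esub> x}"

lemma properly_infinite_iff_matrix_below:
  "properly_infinite R a \<longleftrightarrow>
     a \<in> carrier R \<and> a \<noteq> \<zero>\<^bsub>R\<^esub> \<and> matrix_below R a a \<zero>\<^bsub>R\<^esub> \<zero>\<^bsub>R\<^esub> a"
  unfolding properly_infinite_def matrix_below_def by simp

lemma matrix_below_swap_rows:
  "matrix_below R a m\<^sub>1\<^sub>1 m\<^sub>1\<^sub>2 m\<^sub>2\<^sub>1 m\<^sub>2\<^sub>2 \<Longrightarrow> matrix_below R a m\<^sub>2\<^sub>1 m\<^sub>2\<^sub>2 m\<^sub>1\<^sub>1 m\<^sub>1\<^sub>2"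
  unfolding matrix_below_def by blast

lemma matrix_below_swap_columns:
  "matrix_below R a m\<^sub>1\<^sub>1 m\<^sub>1\<^sub>2 m\<^sub>2\<^sub>1 m\<^sub>2\<^sub>2 \<Longrightarrow> matrix_below R a m\<^sub>1\<^sub>2 m\<^sub>1\<^sub>1 m\<^sub>2\<^sub>2 m\<^sub>2\<^sub>1"
  unfolding matrix_below_def by blast

section \<open>Arithmetic and ideals in rings without identity\<close>

context nonunital_ring
begin

lemma l_null [simp]:
  assumes "x \<in> carrier R"
  shows "\<zero> \<otimes> x = \<zero>"
proof -
  have "\<zero> \<otimes> x \<oplus> \<zero> \<otimes> x = \<zero> \<otimes> x" using assms by (simp flip: l_distr)
  then show ?thesis using assms by (simp add: add.l_cancel_one)
qed

lemma r_null [simp]: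
  assumes "x \<in> carrier R"
  shows "x \<otimes> \<zero> = \<zero>"
proof -
  have "x \<otimes> \<zero> \<oplus> x \<otimes> \<zero> = x \<otimes> \<zero>" using assms by (simp flip: r_distr)
  then show ?thesis using assms by (simp add: add.l_cancel_one)
qed

lemma l_minus:
  assumes "x \<in> carrier R" "y \<in> carrier R"
  shows "(\<ominus> x) \<otimes> y = \<ominus> (x \<otimes> y)"
proof -
  have "(\<ominus> x) \<otimes> y \<oplus> x \<otimes> y = \<zero>"
    using assms by (simp flip: l_distr add: l_neg)
  then show ?thesis using assms by (simp add: minus_equality)
qed

lemma r_minus:
  assumes "x \<in> carrier R" "y \<in> carrier R"
  shows "x \<otimes> (\<ominus> y) = \<ominus> (x \<otimes> y)"
proof -
  have "x \<otimes> (\<ominus> y) \<oplus> x \<otimes> y = \<zero>"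
    using assms by (simp flip: r_distr add: l_neg)
  then show ?thesis using assms by (simp add: minus_equality)
qed

lemma nonunital_idealI:
  assumes "L \<subseteq> carrier R" "L \<noteq> {}"
    and "\<And>x y. \<lbrakk>x \<in> L; y \<in> L\<rbrakk> \<Longrightarrow> x \<oplus> y \<in> L"
    and "\<And>x. x \<in> L \<Longrightarrow> \<ominus> x \<in> L"
    and "\<And>x y. \<lbrakk>x \<in> L; y \<in> carrier R\<rbrakk> \<Longrightarrow> y \<otimes> x \<in> L"
    and "\<And>x y. \<lbrakk>x \<in> L; y \<in> carrier R\<rbrakk> \<Longrightarrow> x \<otimes> y \<in> L"
  shows "nonunital_ideal L R"
proof -
  have "subgroup L (add_monoid R)"
    using assms
    by (intro group.subgroupI[OF a_group]) (auto simp flip: a_inv_def)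
  then show ?thesis
    using assms
    by (intro nonunital_ideal.intro nonunital_ideal_axioms.intro additive_subgroup.intro
        nonunital_ring_axioms) auto
qed

text \<open>
  Sums of products \<open>p \<otimes> x \<otimes> q\<close> are usually needed to generate an ideal. For properly infinite
  \<open>x\<close> single products suffice, because two copies of \<open>x\<close> fit orthogonally below \<open>x\<close>.
\<close>

lemma properly_infinite_products_ideal:
  assumes "properly_infinite R x"
  shows "nonunital_ideal {p \<otimes> x \<otimes> q | p q. p \<in> carrier R \<and> q \<in> carrier R} R"
    (is "nonunital_ideal ?L R")
proof -
  from assms obtain \<alpha>\<^sub>1 \<alpha>\<^sub>2 \<beta>\<^sub>1 \<beta>\<^sub>2 where x: "x \<in> carrier R"
    and car: "\<alpha>\<^sub>1 \<in> carrier R" "\<alpha>\<^sub>2 \<in> carrier R" "\<beta>\<^sub>1 \<in> carrier R" "\<beta>\<^sub>2 \<in> carrier R"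
    and eq: "\<alpha>\<^sub>1 \<otimes> x \<otimes> \<beta>\<^sub>1 = x" "\<alpha>\<^sub>1 \<otimes> x \<otimes> \<beta>\<^sub>2 = \<zero>" "\<alpha>\<^sub>2 \<otimes> x \<otimes> \<beta>\<^sub>1 = \<zero>" "\<alpha>\<^sub>2 \<otimes> x \<otimes> \<beta>\<^sub>2 = x"
    unfolding properly_infinite_def by auto
  show ?thesis
  proof (rule nonunital_idealI)
    show "?L \<subseteq> carrier R" using x by auto
    show "?L \<noteq> {}" using zero_closed by auto
  next
    fix y z assume "y \<in> ?L" "z \<in> ?L"
    then obtain p q p' q' where pq: "p \<in> carrier R" "q \<in> carrier R" "p' \<in> carrier R" "q' \<in> carrier R"
      and y: "y = p \<otimes> x \<otimes> q" and z: "z = p' \<otimes> x \<otimes> q'" by auto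
    have entry: "(l \<otimes> \<alpha>) \<otimes> x \<otimes> (\<beta> \<otimes> k) = l \<otimes> (\<alpha> \<otimes> x \<otimes> \<beta>) \<otimes> k"
      if "l \<in> carrier R" "\<alpha> \<in> carrier R" "\<beta> \<in> carrier R" "k \<in> carrier R" for l \<alpha> \<beta> k
      using that x by (simp add: m_assoc)
    \<comment> \<open>One summand uses the first copy of \<open>x\<close>, the other the second; the cross terms vanish.\<close>
    have "(p \<otimes> \<alpha>\<^sub>1 \<oplus> p' \<otimes> \<alpha>\<^sub>2) \<otimes> x \<otimes> (\<beta>\<^sub>1 \<otimes> q \<oplus> \<beta>\<^sub>2 \<otimes> q')
        = ((p \<otimes> \<alpha>\<^sub>1) \<otimes> x \<otimes> (\<beta>\<^sub>1 \<otimes> q) \<oplus> (p' \<otimes> \<alpha>\<^sub>2) \<otimes> x \<otimes> (\<beta>\<^sub>1 \<otimes> q))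
          \<oplus> ((p \<otimes> \<alpha>\<^sub>1) \<otimes> x \<otimes> (\<beta>\<^sub>2 \<otimes> q') \<oplus> (p' \<otimes> \<alpha>\<^sub>2) \<otimes> x \<otimes> (\<beta>\<^sub>2 \<otimes> q'))"
      using pq car x by (simp add: l_distr r_distr)
    also have "\<dots> = y \<oplus> z"
      using pq car x by (simp add: entry eq y z)
    finally have "y \<oplus> z = (p \<otimes> \<alpha>\<^sub>1 \<oplus> p' \<otimes> \<alpha>\<^sub>2) \<otimes> x \<otimes> (\<beta>\<^sub>1 \<otimes> q \<oplus> \<beta>\<^sub>2 \<otimes> q')" by simp
    moreover have "p \<otimes> \<alpha>\<^sub>1 \<oplus> p' \<otimes> \<alpha>\<^sub>2 \<in> carrier R" "\<beta>\<^sub>1 \<otimes> q \<oplus> \<beta>\<^sub>2 \<otimes> q' \<in> carrier R"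
      using pq car by simp_all
    ultimately show "y \<oplus> z \<in> ?L" by blast
  next
    fix y assume "y \<in> ?L"
    then obtain p q where "p \<in> carrier R" "q \<in> carrier R" "y = p \<otimes> x \<otimes> q" by auto
    then have "\<ominus> y = (\<ominus> p) \<otimes> x \<otimes> q" "\<ominus> p \<in> carrier R" using x by (auto simp: l_minus)
    then show "\<ominus> y \<in> ?L" using \<open>q \<in> carrier R\<close> by blast
  next
    fix y z assume "y \<in> ?L" and z: "z \<in> carrier R"
    then obtain p q where pq: "p \<in> carrier R" "q \<in> carrier R" and y: "y = p \<otimes> x \<otimes> q" by auto
    have "z \<otimes> y = (z \<otimes> p) \<otimes> x \<otimes> q" "y \<otimes> z = p \<otimes> x \<otimes> (q \<otimes> z)"
      using pq x z by (simp_all add: y m_assoc)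
    then show "z \<otimes> y \<in> ?L" "y \<otimes> z \<in> ?L" using pq z by blast+
  qed
qed

section \<open>Absorbing a properly infinite idempotent\<close>

text \<open>
  From \<open>f = r \<otimes> a \<otimes> s\<close>, after replacing \<open>r\<close> by \<open>f \<otimes> r\<close> and \<open>s\<close> by \<open>s \<otimes> f\<close>, the elements
  \<open>g = a \<otimes> s \<otimes> r\<close> and \<open>h = s \<otimes> r \<otimes> a\<close> are idempotents with \<open>g \<otimes> a = a \<otimes> h\<close>. Writing \<open>1\<close> for any
  local unit of \<open>a\<close>, this gives the orthogonal decomposition of \<open>a\<close> into
  \<open>g \<otimes> a \<otimes> h\<close>, which is equivalent to \<open>f\<close>, and \<open>(1 - g) \<otimes> a \<otimes> (1 - h)\<close>. Proper infiniteness of \<open>f\<close>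
  lets the first summand contain two copies of itself: one is used to rebuild \<open>a\<close>, the
  other is the absorbed \<open>f\<close>.
\<close>

lemma properly_infinite_idempotent_absorbed:
  assumes a: "a \<in> carrier R" and u: "u \<in> carrier R" "u \<otimes> a = a" and v: "v \<in> carrier R" "a \<otimes> v = a"
    and r: "r \<in> carrier R" and s: "s \<in> carrier R" and f: "f = r \<otimes> a \<otimes> s"
    and idem: "f \<otimes> f = f" and pi: "matrix_below R f f \<zero> \<zero> f"
  shows "f \<in> absorbed R a"
proof -
  from pi obtain \<gamma>\<^sub>1 \<gamma>\<^sub>2 \<delta>\<^sub>1 \<delta>\<^sub>2 where
    car: "\<gamma>\<^sub>1 \<in> carrier R" "\<gamma>\<^sub>2 \<in> carrier R" "\<delta>\<^sub>1 \<in> carrier R" "\<delta>\<^sub>2 \<in> carrier R"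
    and eq: "\<gamma>\<^sub>1 \<otimes> f \<otimes> \<delta>\<^sub>1 = f" "\<gamma>\<^sub>1 \<otimes> f \<otimes> \<delta>\<^sub>2 = \<zero>" "\<gamma>\<^sub>2 \<otimes> f \<otimes> \<delta>\<^sub>1 = \<zero>" "\<gamma>\<^sub>2 \<otimes> f \<otimes> \<delta>\<^sub>2 = f"
    unfolding matrix_below_def by auto
  have fc: "f \<in> carrier R" using a r s f by simp
  define r' s' t w where defs: "r' = f \<otimes> r" "s' = s \<otimes> f" "t = r' \<otimes> a" "w = a \<otimes> s'"
  have carr: "r' \<in> carrier R" "s' \<in> carrier R" "t \<in> carrier R" "w \<in> carrier R"
    using a r s fc by (simp_all add: defs)
  have ft: "f \<otimes> t = t" and wf: "w \<otimes> f = w"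
    using a r s fc by (simp_all add: defs idem m_assoc[symmetric]) (simp add: m_assoc idem)
  have "r' \<otimes> w = f \<otimes> (r \<otimes> a \<otimes> s) \<otimes> f" "t \<otimes> s' = f \<otimes> (r \<otimes> a \<otimes> s) \<otimes> f"
    using a r s fc by (simp_all add: defs m_assoc)
  then have rw: "r' \<otimes> w = f" and ts: "t \<otimes> s' = f" by (simp_all add: f[symmetric] idem)
  have uw: "u \<otimes> w = w" and tv: "t \<otimes> v = t"
    using a u v carr r by (simp_all add: defs m_assoc[symmetric] s fc)
      (simp add: m_assoc a r s fc v)
  \<comment> \<open>Here \<open>w \<otimes> r' = g\<close> and \<open>s' \<otimes> t = h\<close>. The first two terms act as \<open>1 - g\<close> and \<open>1 - h\<close> and keep the
    complement; the last terms rebuild the summand from the first of the two copies of \<open>f\<close>.\<close>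
  define \<alpha>\<^sub>1 where "\<alpha>\<^sub>1 = u \<ominus> w \<otimes> r' \<oplus> w \<otimes> (\<gamma>\<^sub>1 \<otimes> r')"
  define \<beta>\<^sub>1 where "\<beta>\<^sub>1 = v \<ominus> s' \<otimes> t \<oplus> s' \<otimes> (\<delta>\<^sub>1 \<otimes> t)"
  have car1: "\<alpha>\<^sub>1 \<in> carrier R" "\<beta>\<^sub>1 \<in> carrier R"
    using u v carr car by (simp_all add: \<alpha>\<^sub>1_def \<beta>\<^sub>1_def)
  have \<alpha>a: "\<alpha>\<^sub>1 \<otimes> a = a \<ominus> w \<otimes> t \<oplus> w \<otimes> (\<gamma>\<^sub>1 \<otimes> t)"
    using a u carr car by (simp add: \<alpha>\<^sub>1_def minus_eq l_distr l_minus m_assoc defs(3))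
  have \<alpha>w: "\<alpha>\<^sub>1 \<otimes> w = w \<otimes> (\<gamma>\<^sub>1 \<otimes> f)"
    using u carr car fc
    by (simp add: \<alpha>\<^sub>1_def minus_eq l_distr l_minus m_assoc rw uw wf r_neg)
  have t\<beta>: "t \<otimes> \<beta>\<^sub>1 = f \<otimes> (\<delta>\<^sub>1 \<otimes> t)"
    using v carr car fc
    by (simp add: \<beta>\<^sub>1_def minus_eq r_distr r_minus m_assoc[symmetric] ts tv ft r_neg)
  have a\<beta>: "a \<otimes> \<beta>\<^sub>1 = a \<ominus> w \<otimes> t \<oplus> w \<otimes> (\<delta>\<^sub>1 \<otimes> t)"
    using a v carr car
    by (simp add: \<beta>\<^sub>1_def minus_eq r_distr r_minus m_assoc[symmetric] defs(4)[symmetric])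
  have "\<alpha>\<^sub>1 \<otimes> a \<otimes> \<beta>\<^sub>1 = \<alpha>\<^sub>1 \<otimes> (a \<ominus> w \<otimes> t \<oplus> w \<otimes> (\<delta>\<^sub>1 \<otimes> t))"
    using a car1 by (simp add: m_assoc a\<beta>)
  also have "\<dots> = \<alpha>\<^sub>1 \<otimes> a \<ominus> (\<alpha>\<^sub>1 \<otimes> w) \<otimes> t \<oplus> (\<alpha>\<^sub>1 \<otimes> w) \<otimes> (\<delta>\<^sub>1 \<otimes> t)"
    using a carr car car1 by (simp add: minus_eq r_distr r_minus m_assoc)
  also have "\<dots> = (a \<ominus> w \<otimes> t \<oplus> w \<otimes> (\<gamma>\<^sub>1 \<otimes> t)) \<ominus> (w \<otimes> (\<gamma>\<^sub>1 \<otimes> f)) \<otimes> t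
      \<oplus> (w \<otimes> (\<gamma>\<^sub>1 \<otimes> f)) \<otimes> (\<delta>\<^sub>1 \<otimes> t)"
    by (simp only: \<alpha>a \<alpha>w)
  also have "(w \<otimes> (\<gamma>\<^sub>1 \<otimes> f)) \<otimes> t = w \<otimes> (\<gamma>\<^sub>1 \<otimes> t)"
    using carr car fc by (simp add: m_assoc ft)
  also have "(w \<otimes> (\<gamma>\<^sub>1 \<otimes> f)) \<otimes> (\<delta>\<^sub>1 \<otimes> t) = w \<otimes> (\<gamma>\<^sub>1 \<otimes> f \<otimes> \<delta>\<^sub>1) \<otimes> t"
    using carr car fc by (simp add: m_assoc)
  also have "\<dots> = w \<otimes> t" by (simp add: eq wf)
  also have "(a \<ominus> w \<otimes> t \<oplus> w \<otimes> (\<gamma>\<^sub>1 \<otimes> t)) \<ominus> w \<otimes> (\<gamma>\<^sub>1 \<otimes> t) \<oplus> w \<otimes> t = a"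
    using a carr car by (simp add: minus_eq a_assoc r_neg l_neg)
  finally have e11: "\<alpha>\<^sub>1 \<otimes> a \<otimes> \<beta>\<^sub>1 = a" .
  have "\<alpha>\<^sub>1 \<otimes> a \<otimes> (s' \<otimes> \<delta>\<^sub>2) = \<alpha>\<^sub>1 \<otimes> w \<otimes> \<delta>\<^sub>2"
    using a carr car car1 by (simp add: defs(4) m_assoc)
  also have "\<dots> = w \<otimes> (\<gamma>\<^sub>1 \<otimes> f \<otimes> \<delta>\<^sub>2)" using carr car fc by (simp add: \<alpha>w m_assoc)
  also have "\<dots> = \<zero>" using carr by (simp add: eq)
  finally have e12: "\<alpha>\<^sub>1 \<otimes> a \<otimes> (s' \<otimes> \<delta>\<^sub>2) = \<zero>" .
  have "(\<gamma>\<^sub>2 \<otimes> r') \<otimes> a \<otimes> \<beta>\<^sub>1 = \<gamma>\<^sub>2 \<otimes> (t \<otimes> \<beta>\<^sub>1)"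
    using a carr car car1 by (simp add: defs(3) m_assoc)
  also have "\<dots> = (\<gamma>\<^sub>2 \<otimes> f \<otimes> \<delta>\<^sub>1) \<otimes> t" using carr car fc by (simp add: t\<beta> m_assoc)
  also have "\<dots> = \<zero>" using carr by (simp add: eq)
  finally have e21: "(\<gamma>\<^sub>2 \<otimes> r') \<otimes> a \<otimes> \<beta>\<^sub>1 = \<zero>" .
  have "(\<gamma>\<^sub>2 \<otimes> r') \<otimes> a \<otimes> (s' \<otimes> \<delta>\<^sub>2) = \<gamma>\<^sub>2 \<otimes> (r' \<otimes> w) \<otimes> \<delta>\<^sub>2"
    using a carr car by (simp add: defs(4) m_assoc)
  also have "\<dots> = f" by (simp add: rw eq)
  finally have e22: "(\<gamma>\<^sub>2 \<otimes> r') \<otimes> a \<otimes> (s' \<otimes> \<delta>\<^sub>2) = f" .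
  have "matrix_below R a a \<zero> \<zero> f"
    unfolding matrix_below_def using e11 e12 e21 e22 car1 car carr
    by (intro bexI[of _ \<alpha>\<^sub>1] bexI[of _ "\<gamma>\<^sub>2 \<otimes> r'"] bexI[of _ \<beta>\<^sub>1] bexI[of _ "s' \<otimes> \<delta>\<^sub>2"]) auto
  with fc show ?thesis by (simp add: absorbed_def)
qed

end

section \<open>The ideal of absorbed elements\<close>

context s_unital_ring
begin

text \<open>
  Since \<open>diag(a, k)\<close> lies below \<open>a\<close>, one can work inside the first copy of \<open>a\<close> to obtain the given
  matrix and add the second summand \<open>k\<close> to a single entry. Local units
  of \<open>k\<close> take the place of an identity in attaching it.
\<close>

lemma matrix_below_add_absorbed:
  assumes a: "a \<in> carrier R" and M: "matrix_below R a m\<^sub>1\<^sub>1 m\<^sub>1\<^sub>2 m\<^sub>2\<^sub>1 m\<^sub>2\<^sub>2" and k: "k \<in> absorbed R a"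
  shows "matrix_below R a (m\<^sub>1\<^sub>1 \<oplus> k) m\<^sub>1\<^sub>2 m\<^sub>2\<^sub>1 m\<^sub>2\<^sub>2"
proof -
  from M obtain \<alpha>\<^sub>1 \<alpha>\<^sub>2 \<beta>\<^sub>1 \<beta>\<^sub>2 where
    car: "\<alpha>\<^sub>1 \<in> carrier R" "\<alpha>\<^sub>2 \<in> carrier R" "\<beta>\<^sub>1 \<in> carrier R" "\<beta>\<^sub>2 \<in> carrier R"
    and m: "\<alpha>\<^sub>1 \<otimes> a \<otimes> \<beta>\<^sub>1 = m\<^sub>1\<^sub>1" "\<alpha>\<^sub>1 \<otimes> a \<otimes> \<beta>\<^sub>2 = m\<^sub>1\<^sub>2"
      "\<alpha>\<^sub>2 \<otimes> a \<otimes> \<beta>\<^sub>1 = m\<^sub>2\<^sub>1" "\<alpha>\<^sub>2 \<otimes> a \<otimes> \<beta>\<^sub>2 = m\<^sub>2\<^sub>2"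
    unfolding matrix_below_def by auto
  from k obtain \<gamma>\<^sub>1 \<gamma>\<^sub>2 \<delta>\<^sub>1 \<delta>\<^sub>2 where kc: "k \<in> carrier R" and
    car': "\<gamma>\<^sub>1 \<in> carrier R" "\<gamma>\<^sub>2 \<in> carrier R" "\<delta>\<^sub>1 \<in> carrier R" "\<delta>\<^sub>2 \<in> carrier R"
    and e: "\<gamma>\<^sub>1 \<otimes> a \<otimes> \<delta>\<^sub>1 = a" "\<gamma>\<^sub>1 \<otimes> a \<otimes> \<delta>\<^sub>2 = \<zero>" "\<gamma>\<^sub>2 \<otimes> a \<otimes> \<delta>\<^sub>1 = \<zero>" "\<gamma>\<^sub>2 \<otimes> a \<otimes> \<delta>\<^sub>2 = k"
    unfolding absorbed_def matrix_below_def by auto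
  obtain u v where uv: "u \<in> carrier R" "v \<in> carrier R" "u \<otimes> k = k" "k \<otimes> v = k"
    using s_unital[OF kc] by auto
  have entry: "(l \<otimes> \<gamma>) \<otimes> a \<otimes> (\<delta> \<otimes> l') = l \<otimes> (\<gamma> \<otimes> a \<otimes> \<delta>) \<otimes> l'"
    if "l \<in> carrier R" "\<gamma> \<in> carrier R" "\<delta> \<in> carrier R" "l' \<in> carrier R" for l \<gamma> \<delta> l'
    using that a by (simp add: m_assoc)
  \<comment> \<open>Only the first row and the first column see the second summand.\<close>
  let ?\<alpha> = "\<alpha>\<^sub>1 \<otimes> \<gamma>\<^sub>1 \<oplus> u \<otimes> \<gamma>\<^sub>2" and ?\<beta> = "\<delta>\<^sub>1 \<otimes> \<beta>\<^sub>1 \<oplus> \<delta>\<^sub>2 \<otimes> v"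
  have "?\<alpha> \<otimes> a \<otimes> ?\<beta> = m\<^sub>1\<^sub>1 \<oplus> k" "?\<alpha> \<otimes> a \<otimes> (\<delta>\<^sub>1 \<otimes> \<beta>\<^sub>2) = m\<^sub>1\<^sub>2"
    "(\<alpha>\<^sub>2 \<otimes> \<gamma>\<^sub>1) \<otimes> a \<otimes> ?\<beta> = m\<^sub>2\<^sub>1" "(\<alpha>\<^sub>2 \<otimes> \<gamma>\<^sub>1) \<otimes> a \<otimes> (\<delta>\<^sub>1 \<otimes> \<beta>\<^sub>2) = m\<^sub>2\<^sub>2"
    using car car' a uv kc by (simp_all add: l_distr r_distr entry e m[symmetric])
  moreover have "?\<alpha> \<in> carrier R" "?\<beta> \<in> carrier R" "\<delta>\<^sub>1 \<otimes> \<beta>\<^sub>2 \<in> carrier R" "\<alpha>\<^sub>2 \<otimes> \<gamma>\<^sub>1 \<in> carrier R"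
    using car car' uv by simp_all
  ultimately show ?thesis unfolding matrix_below_def by blast
qed

text \<open>
  Additive closure is the preceding lemma applied to \<open>diag(x, a)\<close>, and multiples are absorbed
  because the second row or column of the witnesses can be rescaled freely.
\<close>

lemma absorbed_ideal:
  assumes a: "a \<in> carrier R"
  shows "nonunital_ideal (absorbed R a) R"
proof (rule nonunital_idealI)
  show "absorbed R a \<subseteq> carrier R" by (auto simp: absorbed_def)
  obtain u v where "u \<in> carrier R" "v \<in> carrier R" "u \<otimes> a = a" "a \<otimes> v = a"
    using s_unital[OF a] by auto
  then have "matrix_below R a a \<zero> \<zero> \<zero>"
    unfolding matrix_below_def using a
    by (intro bexI[of _ u] bexI[of _ \<zero>] bexI[of _ v] bexI[of _ \<zero>]) auto
  then show "absorbed R a \<noteq> {}" by (auto simp: absorbed_def)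
next
  fix x y assume x: "x \<in> absorbed R a" and y: "y \<in> absorbed R a"
  have "matrix_below R a x \<zero> \<zero> a"
    using x by (simp add: absorbed_def matrix_below_swap_rows[OF matrix_below_swap_columns])
  from matrix_below_add_absorbed[OF a this y] have "matrix_below R a a \<zero> \<zero> (x \<oplus> y)"
    by (rule matrix_below_swap_rows[OF matrix_below_swap_columns])
  with x y show "x \<oplus> y \<in> absorbed R a" by (simp add: absorbed_def)
next
  fix x assume "x \<in> absorbed R a"
  then obtain \<alpha>\<^sub>1 \<alpha>\<^sub>2 \<beta>\<^sub>1 \<beta>\<^sub>2 where x: "x \<in> carrier R" and
    car: "\<alpha>\<^sub>1 \<in> carrier R" "\<alpha>\<^sub>2 \<in> carrier R" "\<beta>\<^sub>1 \<in> carrier R" "\<beta>\<^sub>2 \<in> carrier R"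
    and e: "\<alpha>\<^sub>1 \<otimes> a \<otimes> \<beta>\<^sub>1 = a" "\<alpha>\<^sub>1 \<otimes> a \<otimes> \<beta>\<^sub>2 = \<zero>" "\<alpha>\<^sub>2 \<otimes> a \<otimes> \<beta>\<^sub>1 = \<zero>" "\<alpha>\<^sub>2 \<otimes> a \<otimes> \<beta>\<^sub>2 = x"
    unfolding absorbed_def matrix_below_def by auto
  have "matrix_below R a a \<zero> \<zero> (\<ominus> x)"
    unfolding matrix_below_def using car e a
    by (intro bexI[of _ \<alpha>\<^sub>1] bexI[of _ "\<ominus> \<alpha>\<^sub>2"] bexI[of _ \<beta>\<^sub>1] bexI[of _ \<beta>\<^sub>2]) (auto simp: l_minus)
  then show "\<ominus> x \<in> absorbed R a" using x by (simp add: absorbed_def)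
  fix y assume y: "y \<in> carrier R"
  have "matrix_below R a a \<zero> \<zero> (y \<otimes> x)"
    unfolding matrix_below_def using car e a y
    by (intro bexI[of _ \<alpha>\<^sub>1] bexI[of _ "y \<otimes> \<alpha>\<^sub>2"] bexI[of _ \<beta>\<^sub>1] bexI[of _ \<beta>\<^sub>2])
      (auto simp: m_assoc)
  then show "y \<otimes> x \<in> absorbed R a" using x y by (simp add: absorbed_def)
  have "matrix_below R a a \<zero> \<zero> (x \<otimes> y)"
    unfolding matrix_below_def using car e a y
    by (intro bexI[of _ \<alpha>\<^sub>1] bexI[of _ "\<alpha>\<^sub>2"] bexI[of _ \<beta>\<^sub>1] bexI[of _ "\<beta>\<^sub>2 \<otimes> y"])
      (auto simp flip: m_assoc)
  then show "x \<otimes> y \<in> absorbed R a" using x y by (simp add: absorbed_def)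
qed

text \<open>
  The errors are cancelled one at a time, each being moved to the top left corner by swapping
  rows or columns.
\<close>

lemma matrix_below_cong_absorbed:
  assumes a: "a \<in> carrier R"
    and M: "matrix_below R a (h\<^sub>1\<^sub>1 \<oplus> m\<^sub>1\<^sub>1) (h\<^sub>1\<^sub>2 \<oplus> m\<^sub>1\<^sub>2) (h\<^sub>2\<^sub>1 \<oplus> m\<^sub>2\<^sub>1) (h\<^sub>2\<^sub>2 \<oplus> m\<^sub>2\<^sub>2)"
    and h: "h\<^sub>1\<^sub>1 \<in> absorbed R a" "h\<^sub>1\<^sub>2 \<in> absorbed R a" "h\<^sub>2\<^sub>1 \<in> absorbed R a" "h\<^sub>2\<^sub>2 \<in> absorbed R a"
    and m: "m\<^sub>1\<^sub>1 \<in> carrier R" "m\<^sub>1\<^sub>2 \<in> carrier R" "m\<^sub>2\<^sub>1 \<in> carrier R" "m\<^sub>2\<^sub>2 \<in> carrier R"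
  shows "matrix_below R a m\<^sub>1\<^sub>1 m\<^sub>1\<^sub>2 m\<^sub>2\<^sub>1 m\<^sub>2\<^sub>2"
proof -
  interpret K: nonunital_ideal "absorbed R a" R by (rule absorbed_ideal[OF a])
  have cancel: "matrix_below R a x p q r"
    if "matrix_below R a (h \<oplus> x) p q r" "h \<in> absorbed R a" "x \<in> carrier R" for h x p q r
  proof -
    have "matrix_below R a (h \<oplus> x \<oplus> \<ominus> h) p q r"
      using matrix_below_add_absorbed[OF a that(1)] that(2) by simp
    moreover have "h \<oplus> x \<oplus> \<ominus> h = x"
      using that K.a_Hcarr[OF that(2)] by (simp add: a_comm[of h x] a_assoc r_neg)
    ultimately show ?thesis by simp
  qed
  note rows = matrix_below_swap_rows and columns = matrix_below_swap_columns
  have "matrix_below R a (h\<^sub>1\<^sub>2 \<oplus> m\<^sub>1\<^sub>2) m\<^sub>1\<^sub>1 (h\<^sub>2\<^sub>2 \<oplus> m\<^sub>2\<^sub>2) (h\<^sub>2\<^sub>1 \<oplus> m\<^sub>2\<^sub>1)"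
    using cancel[OF M h(1) m(1)] by (rule columns)
  then have "matrix_below R a (h\<^sub>2\<^sub>2 \<oplus> m\<^sub>2\<^sub>2) (h\<^sub>2\<^sub>1 \<oplus> m\<^sub>2\<^sub>1) m\<^sub>1\<^sub>2 m\<^sub>1\<^sub>1"
    by (rule rows[OF cancel[OF _ h(2) m(2)]])
  then have "matrix_below R a (h\<^sub>2\<^sub>1 \<oplus> m\<^sub>2\<^sub>1) m\<^sub>2\<^sub>2 m\<^sub>1\<^sub>1 m\<^sub>1\<^sub>2"
    by (rule columns[OF cancel[OF _ h(4) m(4)]])
  then show ?thesis
    by (rule rows[OF cancel[OF _ h(3) m(3)]])
qed

end

section \<open>Passing to quotients and to ideals\<close>

context nonunital_ideal
begin

lemma abelian_subgroup_ideal: "abelian_subgroup I R"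
  by (rule abelian_subgroupI3) unfold_locales

lemma rcos_eq_iff:
  assumes "x \<in> carrier R" "y \<in> carrier R"
  shows "I +> x = I +> y \<longleftrightarrow> (\<exists>h \<in> I. x = h \<oplus> y)"
proof -
  have "I +> x = I +> y \<longleftrightarrow> x \<in> I +> y"
    using assms abelian_subgroup.a_rcos_self[OF abelian_subgroup_ideal]
      a_repr_independence[OF _ _ a_subgroup] by metis
  then show ?thesis by (auto simp: a_r_coset_def')
qed

lemma rcos_eq_ideal_iff:
  assumes "x \<in> carrier R"
  shows "I +> x = I \<longleftrightarrow> x \<in> I"
proof -
  have "I +> \<zero> = I" using a_coset_add_zero a_subset by simp
  with rcos_eq_iff[OF assms abelian_monoid.zero_closed[OF abelian_monoid_axioms]] show ?thesis
    using a_subset by (metis a_Hcarr r_zero)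
qed

lemma matrix_below_quot_iff:
  assumes "a \<in> carrier R" "m\<^sub>1\<^sub>1 \<in> carrier R" "m\<^sub>1\<^sub>2 \<in> carrier R" "m\<^sub>2\<^sub>1 \<in> carrier R" "m\<^sub>2\<^sub>2 \<in> carrier R"
  shows "matrix_below (R Quot I) (I +> a) (I +> m\<^sub>1\<^sub>1) (I +> m\<^sub>1\<^sub>2) (I +> m\<^sub>2\<^sub>1) (I +> m\<^sub>2\<^sub>2) \<longleftrightarrow>
     (\<exists>h\<^sub>1\<^sub>1 \<in> I. \<exists>h\<^sub>1\<^sub>2 \<in> I. \<exists>h\<^sub>2\<^sub>1 \<in> I. \<exists>h\<^sub>2\<^sub>2 \<in> I.
        matrix_below R a (h\<^sub>1\<^sub>1 \<oplus> m\<^sub>1\<^sub>1) (h\<^sub>1\<^sub>2 \<oplus> m\<^sub>1\<^sub>2) (h\<^sub>2\<^sub>1 \<oplus> m\<^sub>2\<^sub>1) (h\<^sub>2\<^sub>2 \<oplus> m\<^sub>2\<^sub>2))"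
    (is "?L \<longleftrightarrow> ?R")
proof -
  have entry: "I +> (\<alpha> \<otimes> a \<otimes> \<beta>) = I +> m \<longleftrightarrow> (\<exists>h \<in> I. \<alpha> \<otimes> a \<otimes> \<beta> = h \<oplus> m)"
    if "\<alpha> \<in> carrier R" "\<beta> \<in> carrier R" "m \<in> carrier R" for \<alpha> \<beta> m
    using that assms by (intro rcos_eq_iff) auto
  have "?L \<longleftrightarrow> (\<exists>\<alpha>\<^sub>1 \<in> carrier R. \<exists>\<alpha>\<^sub>2 \<in> carrier R. \<exists>\<beta>\<^sub>1 \<in> carrier R. \<exists>\<beta>\<^sub>2 \<in> carrier R.
        I +> (\<alpha>\<^sub>1 \<otimes> a \<otimes> \<beta>\<^sub>1) = I +> m\<^sub>1\<^sub>1 \<and> I +> (\<alpha>\<^sub>1 \<otimes> a \<otimes> \<beta>\<^sub>2) = I +> m\<^sub>1\<^sub>2 \<and>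
        I +> (\<alpha>\<^sub>2 \<otimes> a \<otimes> \<beta>\<^sub>1) = I +> m\<^sub>2\<^sub>1 \<and> I +> (\<alpha>\<^sub>2 \<otimes> a \<otimes> \<beta>\<^sub>2) = I +> m\<^sub>2\<^sub>2)"
    unfolding matrix_below_def using assms by (simp add: FactRing_simps rcoset_mult_add)
  also have "\<dots> \<longleftrightarrow> ?R"
    unfolding matrix_below_def using assms by (simp add: entry cong: bex_cong) blast
  finally show ?thesis .
qed

lemma quot_zero_eq_rcos:
  shows "\<zero>\<^bsub>R Quot I\<^esub> = I +> \<zero>"
  using rcos_eq_ideal_iff[of \<zero>] by (simp add: FactRing_def)

lemma image_ideal_quot:
  assumes "nonunital_ideal L R"
  shows "nonunital_ideal ((+>) I ` L) (R Quot I)"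
proof -
  interpret L: nonunital_ideal L R by fact
  interpret Q: nonunital_ring "R Quot I" by (rule quotient_is_ring)
  have add: "(I +> x) \<oplus>\<^bsub>R Quot I\<^esub> (I +> y) = I +> (x \<oplus> y)" if "x \<in> carrier R" "y \<in> carrier R" for x y
    using abelian_subgroup.a_rcos_sum[OF abelian_subgroup_ideal] that by (simp add: FactRing_def)
  have car: "I +> x \<in> carrier (R Quot I)" if "x \<in> carrier R" for x
    using that by (auto simp: FactRing_simps)
  have neg: "\<ominus>\<^bsub>R Quot I\<^esub> (I +> x) = I +> (\<ominus> x)" if "x \<in> carrier R" for x
    using that by (intro Q.minus_equality) (simp_all add: add car quot_zero_eq_rcos l_neg)
  show ?thesis
  proof (rule Q.nonunital_idealI)
    show "(+>) I ` L \<subseteq> carrier (R Quot I)" using car L.a_Hcarr by auto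
    show "(+>) I ` L \<noteq> {}" using additive_subgroup.zero_closed[OF L.additive_subgroup_axioms] by blast
  next
    fix X Y assume "X \<in> (+>) I ` L" "Y \<in> (+>) I ` L"
    then show "X \<oplus>\<^bsub>R Quot I\<^esub> Y \<in> (+>) I ` L" by (auto simp: add L.a_Hcarr)
  next
    fix X assume "X \<in> (+>) I ` L"
    then show "\<ominus>\<^bsub>R Quot I\<^esub> X \<in> (+>) I ` L" by (auto simp: neg L.a_Hcarr)
  next
    fix X Y assume "X \<in> (+>) I ` L" "Y \<in> carrier (R Quot I)"
    then show "Y \<otimes>\<^bsub>R Quot I\<^esub> X \<in> (+>) I ` L" "X \<otimes>\<^bsub>R Quot I\<^esub> Y \<in> (+>) I ` L"
      by (auto simp: FactRing_simps rcoset_mult_add L.a_Hcarr L.I_l_closed L.I_r_closed)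
  qed
qed

text \<open>
  This turns the existence of idempotents in the ideals of a quotient into a statement about
  elements of the ring, applied to the image of \<open>L\<close>.
\<close>

lemma idempotent_mod_ideal:
  assumes idem: "\<And>K. \<lbrakk>nonunital_ideal K (R Quot I); K \<noteq> {\<zero>\<^bsub>R Quot I\<^esub>}\<rbrakk>
      \<Longrightarrow> \<exists>e \<in> K. e \<in> idempotents (R Quot I) \<and> e \<noteq> \<zero>\<^bsub>R Quot I\<^esub>"
    and L: "nonunital_ideal L R" and not_sub: "\<not> L \<subseteq> I"
  shows "\<exists>y \<in> L. y \<notin> I \<and> (\<exists>h \<in> I. y \<otimes> y = h \<oplus> y)"
proof -
  interpret L: nonunital_ideal L R by fact
  from not_sub obtain x where "x \<in> L" "x \<notin> I" by auto
  then have "(+>) I ` L \<noteq> {\<zero>\<^bsub>R Quot I\<^esub>}"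
    using rcos_eq_ideal_iff[of x] L.a_Hcarr[of x] by (auto simp: FactRing_def)
  from idem[OF image_ideal_quot[OF L] this] obtain y where y: "y \<in> L"
    and "I +> y \<in> idempotents (R Quot I)" "I +> y \<noteq> \<zero>\<^bsub>R Quot I\<^esub>" by auto
  moreover note yc = L.a_Hcarr[OF y]
  ultimately have "I +> (y \<otimes> y) = I +> y" "y \<notin> I"
    using rcos_eq_ideal_iff[OF yc] by (auto simp: idempotents_def FactRing_def rcoset_mult_add)
  then show ?thesis using y yc rcos_eq_iff[of "y \<otimes> y" y] by auto
qed

lemma ideal_in_ideal:
  assumes "nonunital_ideal K R"
  shows "nonunital_ideal (I \<inter> K) (R\<lparr>carrier := I\<rparr>)"
proof -
  interpret K: nonunital_ideal K R by fact
  interpret S: nonunital_ring "R\<lparr>carrier := I\<rparr>" by (rule ideal_is_ring)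
  have neg: "\<ominus>\<^bsub>R\<lparr>carrier := I\<rparr>\<^esub> x = \<ominus> x" if "x \<in> I" for x
    using that a_Hcarr[OF that] by (intro S.minus_equality) (auto simp: l_neg)
  show ?thesis
    by (rule S.nonunital_idealI)
      (auto simp: neg I_l_closed I_r_closed K.I_l_closed K.I_r_closed a_Hcarr
        intro: zero_closed K.zero_closed)
qed

lemma properly_infinite_in_ring:
  assumes "properly_infinite (R\<lparr>carrier := I\<rparr>) x"
  shows "properly_infinite R x"
proof -
  from assms obtain \<alpha>\<^sub>1 \<alpha>\<^sub>2 \<beta>\<^sub>1 \<beta>\<^sub>2 where "x \<in> I" "x \<noteq> \<zero>"
    "\<alpha>\<^sub>1 \<in> I" "\<alpha>\<^sub>2 \<in> I" "\<beta>\<^sub>1 \<in> I" "\<beta>\<^sub>2 \<in> I"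
    "\<alpha>\<^sub>1 \<otimes> x \<otimes> \<beta>\<^sub>1 = x" "\<alpha>\<^sub>1 \<otimes> x \<otimes> \<beta>\<^sub>2 = \<zero>" "\<alpha>\<^sub>2 \<otimes> x \<otimes> \<beta>\<^sub>1 = \<zero>" "\<alpha>\<^sub>2 \<otimes> x \<otimes> \<beta>\<^sub>2 = x"
    unfolding properly_infinite_def by auto
  then show ?thesis
    unfolding properly_infinite_def using a_Hcarr
    by (intro conjI bexI[of _ \<alpha>\<^sub>1] bexI[of _ \<alpha>\<^sub>2] bexI[of _ \<beta>\<^sub>1] bexI[of _ \<beta>\<^sub>2]) auto
qed

text \<open>
  If \<open>u \<otimes> x = x = x \<otimes> v\<close> with \<open>u, v \<in> I\<close>, then the witnesses \<open>\<alpha>\<^sub>i\<close>, \<open>\<beta>\<^sub>j\<close> in the ring may be replaced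
  by \<open>u \<otimes> \<alpha>\<^sub>i\<close> and \<open>\<beta>\<^sub>j \<otimes> v\<close>, which lie in \<open>I\<close>.
\<close>

lemma properly_infinite_in_s_unital_ideal:
  assumes su: "s_unital_ring (R\<lparr>carrier := I\<rparr>)" and x: "x \<in> I" and pi: "properly_infinite R x"
  shows "properly_infinite (R\<lparr>carrier := I\<rparr>) x"
proof -
  from pi obtain \<alpha>\<^sub>1 \<alpha>\<^sub>2 \<beta>\<^sub>1 \<beta>\<^sub>2 where xc: "x \<in> carrier R" "x \<noteq> \<zero>"
    and car: "\<alpha>\<^sub>1 \<in> carrier R" "\<alpha>\<^sub>2 \<in> carrier R" "\<beta>\<^sub>1 \<in> carrier R" "\<beta>\<^sub>2 \<in> carrier R"
    and eq: "\<alpha>\<^sub>1 \<otimes> x \<otimes> \<beta>\<^sub>1 = x" "\<alpha>\<^sub>1 \<otimes> x \<otimes> \<beta>\<^sub>2 = \<zero>" "\<alpha>\<^sub>2 \<otimes> x \<otimes> \<beta>\<^sub>1 = \<zero>" "\<alpha>\<^sub>2 \<otimes> x \<otimes> \<beta>\<^sub>2 = x"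
    unfolding properly_infinite_def by auto
  obtain u v where uv: "u \<in> I" "v \<in> I" "u \<otimes> x = x" "x \<otimes> v = x"
    using s_unital_ring.s_unital[OF su, of x] x by auto
  note uvc = uv(1,2)[THEN a_Hcarr]
  have entry: "(u \<otimes> \<alpha>) \<otimes> x \<otimes> (\<beta> \<otimes> v) = u \<otimes> (\<alpha> \<otimes> x \<otimes> \<beta>) \<otimes> v"
    if "\<alpha> \<in> carrier R" "\<beta> \<in> carrier R" for \<alpha> \<beta>
    using that xc uvc by (simp add: m_assoc)
  have "matrix_below (R\<lparr>carrier := I\<rparr>) x x \<zero> \<zero> x"
    unfolding matrix_below_def
    by (intro bexI[of _ "u \<otimes> \<alpha>\<^sub>1"] bexI[of _ "u \<otimes> \<alpha>\<^sub>2"] bexI[of _ "\<beta>\<^sub>1 \<otimes> v"] bexI[of _ "\<beta>\<^sub>2 \<otimes> v"])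
      (simp_all add: entry car eq uv uvc I_l_closed I_r_closed)
  then show ?thesis using x xc by (simp add: properly_infinite_iff_matrix_below)
qed

lemma properly_infinite_quot:
  assumes pi: "properly_infinite R x" and x: "x \<notin> I"
  shows "properly_infinite (R Quot I) (I +> x)"
proof -
  have xc: "x \<in> carrier R" and M: "matrix_below R x x \<zero> \<zero> x"
    using pi by (auto simp: properly_infinite_iff_matrix_below)
  have "matrix_below (R Quot I) (I +> x) (I +> x) (I +> \<zero>) (I +> \<zero>) (I +> x)"
    using M xc by (subst matrix_below_quot_iff) (auto intro!: bexI[of _ \<zero>])
  moreover have "I +> x \<noteq> I +> \<zero>" 
    using x rcos_eq_ideal_iff[OF xc] rcos_eq_ideal_iff[of \<zero>] by auto
  moreover have "I +> x \<in> carrier (R Quot I)" using xc by (auto simp: FactRing_simps)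
  ultimately show ?thesis
    by (simp add: properly_infinite_iff_matrix_below quot_zero_eq_rcos)
qed

end

section \<open>Proper infiniteness in extensions\<close>

context s_unital_ring
begin

text \<open>
  Modulo the elements that it absorbs, \<open>a\<close> absorbs nothing new: the errors by which the lifted
  equations fail are themselves absorbed.
\<close>

lemma absorbed_quot_lift:
  assumes a: "a \<in> carrier R" and x: "x \<in> carrier R"
    and abs: "absorbed R a +> x \<in> absorbed (R Quot absorbed R a) (absorbed R a +> a)"
  shows "x \<in> absorbed R a"
proof -
  interpret K: nonunital_ideal "absorbed R a" R by (rule absorbed_ideal[OF a])
  from abs obtain h\<^sub>1\<^sub>1 h\<^sub>1\<^sub>2 h\<^sub>2\<^sub>1 h\<^sub>2\<^sub>2 where
    h: "h\<^sub>1\<^sub>1 \<in> absorbed R a" "h\<^sub>1\<^sub>2 \<in> absorbed R a" "h\<^sub>2\<^sub>1 \<in> absorbed R a" "h\<^sub>2\<^sub>2 \<in> absorbed R a"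
    and M: "matrix_below R a (h\<^sub>1\<^sub>1 \<oplus> a) (h\<^sub>1\<^sub>2 \<oplus> \<zero>) (h\<^sub>2\<^sub>1 \<oplus> \<zero>) (h\<^sub>2\<^sub>2 \<oplus> x)"
    unfolding absorbed_def[of "R Quot absorbed R a"] K.quot_zero_eq_rcos
    using a x by (auto simp: K.matrix_below_quot_iff simp del: r_zero)
  have "matrix_below R a a \<zero> \<zero> x"
    by (rule matrix_below_cong_absorbed[OF a M h]) (simp_all add: a x)
  with x show ?thesis unfolding absorbed_def by blast
qed

text \<open>
  An error \<open>h = \<alpha> \<otimes> a \<otimes> \<beta> - m\<close> with \<open>m \<in> {\<zero>, a}\<close> equals \<open>u \<otimes> h \<otimes> v\<close> for some \<open>u, v \<in> I\<close>, so it is a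
  difference of elements of \<open>I a I\<close>. If all of these are absorbed, so are the errors.
\<close>

lemma properly_infinite_mod_ideal:
  assumes I: "nonunital_ideal I R" and su: "s_unital_ring (R\<lparr>carrier := I\<rparr>)"
    and a: "a \<in> carrier R" "a \<noteq> \<zero>" and pi: "properly_infinite (R Quot I) (I +> a)"
    and sub: "\<And>r s. \<lbrakk>r \<in> I; s \<in> I\<rbrakk> \<Longrightarrow> r \<otimes> a \<otimes> s \<in> absorbed R a"
  shows "properly_infinite R a"
proof -
  interpret I: nonunital_ideal I R by fact
  interpret K: nonunital_ideal "absorbed R a" R by (rule absorbed_ideal[OF a(1)])
  from pi obtain h\<^sub>1\<^sub>1 h\<^sub>1\<^sub>2 h\<^sub>2\<^sub>1 h\<^sub>2\<^sub>2 where h: "h\<^sub>1\<^sub>1 \<in> I" "h\<^sub>1\<^sub>2 \<in> I" "h\<^sub>2\<^sub>1 \<in> I" "h\<^sub>2\<^sub>2 \<in> I"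
    and M: "matrix_below R a (h\<^sub>1\<^sub>1 \<oplus> a) (h\<^sub>1\<^sub>2 \<oplus> \<zero>) (h\<^sub>2\<^sub>1 \<oplus> \<zero>) (h\<^sub>2\<^sub>2 \<oplus> a)"
    using a by (auto simp: properly_infinite_iff_matrix_below I.quot_zero_eq_rcos
        I.matrix_below_quot_iff)
  have abs: "h \<in> absorbed R a"
    if h: "h \<in> I" and \<alpha>: "\<alpha> \<in> carrier R" and \<beta>: "\<beta> \<in> carrier R"
      and m: "m \<in> {\<zero>, a}" and eq: "\<alpha> \<otimes> a \<otimes> \<beta> = h \<oplus> m" for h \<alpha> \<beta> m
  proof -
    obtain u v where uv: "u \<in> I" "v \<in> I" "u \<otimes> h = h" "h \<otimes> v = h"
      using s_unital_ring.s_unital[OF su, of h] h by auto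
    note car = uv(1,2)[THEN I.a_Hcarr] I.a_Hcarr[OF h]
    have mc: "m \<in> carrier R" using m a by auto
    have um: "u \<otimes> m \<otimes> v \<in> absorbed R a"
      using m sub[OF uv(1,2)] car by auto
    have "(u \<otimes> \<alpha>) \<otimes> a \<otimes> (\<beta> \<otimes> v) = u \<otimes> (\<alpha> \<otimes> a \<otimes> \<beta>) \<otimes> v"
      using car \<alpha> \<beta> a by (simp add: m_assoc)
    also have "\<dots> = h \<oplus> u \<otimes> m \<otimes> v"
      using car mc uv by (simp add: eq l_distr r_distr)
    finally have "h \<oplus> u \<otimes> m \<otimes> v \<in> absorbed R a"
      using sub[OF I.I_r_closed[OF uv(1) \<alpha>] I.I_l_closed[OF uv(2) \<beta>]] by simp
    then have "h \<oplus> u \<otimes> m \<otimes> v \<oplus> \<ominus> (u \<otimes> m \<otimes> v) \<in> absorbed R a" using um by simp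
    then show ?thesis using car mc by (simp add: a_assoc r_neg)
  qed
  from M have h_absorbed: "h\<^sub>1\<^sub>1 \<in> absorbed R a" "h\<^sub>1\<^sub>2 \<in> absorbed R a" "h\<^sub>2\<^sub>1 \<in> absorbed R a" "h\<^sub>2\<^sub>2 \<in> absorbed R a"
    unfolding matrix_below_def using abs h by blast+
  have "matrix_below R a a \<zero> \<zero> a"
    by (rule matrix_below_cong_absorbed[OF a(1) M h_absorbed]) (simp_all add: a)
  with a show ?thesis by (simp add: properly_infinite_iff_matrix_below)
qed

text \<open>
  It remains to exclude that some \<open>x = r \<otimes> a \<otimes> s\<close> with \<open>r, s \<in> I\<close> is not absorbed. Such an \<open>x\<close> would
  yield a properly infinite \<open>f \<in> I\<close> of the same form, idempotent modulo the absorbed ideal but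
  outside it. In the quotient by that ideal \<open>f\<close> would be absorbed, and this lifts.
\<close>

lemma properly_infinite_extension:
  assumes I: "nonunital_ideal I R" and su: "s_unital_ring (R\<lparr>carrier := I\<rparr>)"
    and idem: "\<And>J K. \<lbrakk>nonunital_ideal J (R\<lparr>carrier := I\<rparr>);
            nonunital_ideal K ((R\<lparr>carrier := I\<rparr>) Quot J);
            K \<noteq> {\<zero>\<^bsub>(R\<lparr>carrier := I\<rparr>) Quot J\<^esub>}\<rbrakk>
          \<Longrightarrow> \<exists>e \<in> K. e \<in> idempotents ((R\<lparr>carrier := I\<rparr>) Quot J)
                 \<and> e \<noteq> \<zero>\<^bsub>(R\<lparr>carrier := I\<rparr>) Quot J\<^esub>"
    and ppi: "properly_purely_infinite (R\<lparr>carrier := I\<rparr>)"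
    and a: "a \<in> carrier R" "a \<noteq> \<zero>" and pi: "properly_infinite (R Quot I) (I +> a)"
  shows "properly_infinite R a"
proof -
  interpret I: nonunital_ideal I R by fact
  let ?K = "absorbed R a"
  let ?S = "R\<lparr>carrier := I\<rparr>"
  interpret K: nonunital_ideal ?K R by (rule absorbed_ideal[OF a(1)])
  interpret S: s_unital_ring ?S by fact
  interpret J: nonunital_ideal "I \<inter> ?K" ?S by (rule I.ideal_in_ideal) unfold_locales
  interpret Q: nonunital_ring "R Quot ?K" by (rule K.quotient_is_ring)
  have pi_I: "properly_infinite ?S x" if "x \<in> I" "x \<notin> ?K" for x
    using ppi that K.zero_closed by (auto simp: properly_purely_infinite_def)
  have sub: "r \<otimes> a \<otimes> s \<in> ?K" if rs: "r \<in> I" "s \<in> I" for r s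
  proof (rule ccontr)
    assume notin: "r \<otimes> a \<otimes> s \<notin> ?K"
    define x where "x = r \<otimes> a \<otimes> s"
    note rsc = rs[THEN I.a_Hcarr]
    have x: "x \<in> I" "x \<notin> ?K" using rs rsc a notin by (auto simp: x_def I.I_l_closed I.I_r_closed)
    let ?L = "{p \<otimes>\<^bsub>?S\<^esub> x \<otimes>\<^bsub>?S\<^esub> q | p q. p \<in> carrier ?S \<and> q \<in> carrier ?S}"
    have L: "nonunital_ideal ?L ?S"
      by (rule S.properly_infinite_products_ideal[OF pi_I[OF x]])
    obtain \<alpha> \<beta> where "\<alpha> \<in> I" "\<beta> \<in> I" "\<alpha> \<otimes> x \<otimes> \<beta> = x"
      using pi_I[OF x] unfolding properly_infinite_def by auto
    then have "x \<in> ?L" by (intro CollectI exI[of _ \<alpha>] exI[of _ \<beta>]) simp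
    then have "\<not> ?L \<subseteq> I \<inter> ?K" using x by blast
    from J.idempotent_mod_ideal[OF idem[OF J.nonunital_ideal_axioms] L this]
    obtain p q h where pq: "p \<in> I" "q \<in> I" and h: "h \<in> ?K"
      and f: "p \<otimes> x \<otimes> q \<notin> I \<inter> ?K" "(p \<otimes> x \<otimes> q) \<otimes> (p \<otimes> x \<otimes> q) = h \<oplus> p \<otimes> x \<otimes> q" by auto
    note car = pq[THEN I.a_Hcarr] I.a_Hcarr[OF x(1)]
    define f where "f = p \<otimes> x \<otimes> q"
    have fI: "f \<in> I" using pq car x by (simp add: f_def I.I_l_closed I.I_r_closed)
    note fc = I.a_Hcarr[OF fI]
    have fK: "f \<notin> ?K" using f fI by (simp add: f_def)
    have f_eq: "f = (p \<otimes> r) \<otimes> a \<otimes> (s \<otimes> q)"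
      using car rsc a by (simp add: f_def x_def m_assoc)
    have ff: "?K +> (f \<otimes> f) = ?K +> f"
      using fc h f(2) K.rcos_eq_iff by (auto simp: f_def)
    have "properly_infinite (R Quot ?K) (?K +> f)"
      by (intro K.properly_infinite_quot I.properly_infinite_in_ring pi_I fI fK)
    then have f_pi: "matrix_below (R Quot ?K) (?K +> f) (?K +> f) \<zero>\<^bsub>R Quot ?K\<^esub> \<zero>\<^bsub>R Quot ?K\<^esub> (?K +> f)"
      by (simp add: properly_infinite_iff_matrix_below)
    obtain u v where uv: "u \<in> carrier R" "v \<in> carrier R" "u \<otimes> a = a" "a \<otimes> v = a"
      using s_unital[OF a(1)] by auto
    have mult: "(?K +> y) \<otimes>\<^bsub>R Quot ?K\<^esub> (?K +> z) = ?K +> (y \<otimes> z)"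
      if "y \<in> carrier R" "z \<in> carrier R" for y z
      using that by (simp add: FactRing_simps K.rcoset_mult_add)
    have Qc: "?K +> y \<in> carrier (R Quot ?K)" if "y \<in> carrier R" for y
      using that by (auto simp: FactRing_simps)
    have "?K +> f \<in> absorbed (R Quot ?K) (?K +> a)"
      by (rule Q.properly_infinite_idempotent_absorbed[where u = "?K +> u" and v = "?K +> v"
            and r = "?K +> (p \<otimes> r)" and s = "?K +> (s \<otimes> q)"])
        (use uv a car rsc fc f_pi in \<open>simp_all add: mult Qc ff f_eq[symmetric]\<close>)
    then have "f \<in> ?K" by (rule absorbed_quot_lift[OF a(1) fc])
    with fK show False by blast
  qed
  show ?thesis by (rule properly_infinite_mod_ideal[OF I su a pi]) (rule sub)
qed

end

theorem proposition3p9: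
  fixes R :: "('a, 'b) ring_scheme" and I :: "'a set"
  assumes "s_unital_ring R"
    and "nonunital_ideal I R"
    and "s_unital_ring (R\<lparr>carrier := I\<rparr>)"
    and "\<And>J K. \<lbrakk>nonunital_ideal J (R\<lparr>carrier := I\<rparr>);
            nonunital_ideal K ((R\<lparr>carrier := I\<rparr>) Quot J);
            K \<noteq> {\<zero>\<^bsub>(R\<lparr>carrier := I\<rparr>) Quot J\<^esub>}\<rbrakk>
          \<Longrightarrow> \<exists>e \<in> K. e \<in> idempotents ((R\<lparr>carrier := I\<rparr>) Quot J)
                 \<and> e \<noteq> \<zero>\<^bsub>(R\<lparr>carrier := I\<rparr>) Quot J\<^esub>"
  shows "properly_purely_infinite R \<longleftrightarrow>
           properly_purely_infinite (R\<lparr>carrier := I\<rparr>) \<and> properly_purely_infinite (R Quot I)"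
proof -
  interpret R: s_unital_ring R by (rule assms(1))
  interpret I: nonunital_ideal I R by (rule assms(2))
  show ?thesis
  proof
    assume ppi: "properly_purely_infinite R"
    then have pi: "properly_infinite R x" if "x \<in> carrier R" "x \<noteq> \<zero>\<^bsub>R\<^esub>" for x
      using that unfolding properly_purely_infinite_def by blast
    have "properly_purely_infinite (R\<lparr>carrier := I\<rparr>)"
      unfolding properly_purely_infinite_def
    proof (intro ballI impI)
      fix x assume "x \<in> carrier (R\<lparr>carrier := I\<rparr>)" "x \<noteq> \<zero>\<^bsub>R\<lparr>carrier := I\<rparr>\<^esub>"
      then have x: "x \<in> I" "x \<noteq> \<zero>\<^bsub>R\<^esub>" by simp_all
      show "properly_infinite (R\<lparr>carrier := I\<rparr>) x"
        by (rule I.properly_infinite_in_s_unital_ideal[OF assms(3) x(1) pi[OF I.a_Hcarr[OF x(1)] x(2)]])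
    qed
    moreover have "properly_purely_infinite (R Quot I)"
      unfolding properly_purely_infinite_def
    proof (intro ballI impI)
      fix X assume "X \<in> carrier (R Quot I)" and nz: "X \<noteq> \<zero>\<^bsub>R Quot I\<^esub>"
      then obtain x where x: "x \<in> carrier R" "X = I +>\<^bsub>R\<^esub> x" by (auto simp: FactRing_simps)
      have "x \<notin> I" using nz x I.rcos_eq_ideal_iff by (auto simp: FactRing_def)
      moreover from this have "x \<noteq> \<zero>\<^bsub>R\<^esub>" using I.zero_closed by blast
      ultimately show "properly_infinite (R Quot I) X"
        unfolding x(2) by (intro I.properly_infinite_quot pi x(1))
    qed
    ultimately show "properly_purely_infinite (R\<lparr>carrier := I\<rparr>) \<and> properly_purely_infinite (R Quot I)" ..
  next
    assume "properly_purely_infinite (R\<lparr>carrier := I\<rparr>) \<and> properly_purely_infinite (R Quot I)"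
    then have ppi: "properly_purely_infinite (R\<lparr>carrier := I\<rparr>)"
      and quot: "properly_purely_infinite (R Quot I)" by simp_all
    show "properly_purely_infinite R"
      unfolding properly_purely_infinite_def
    proof (intro ballI impI)
      fix a assume a: "a \<in> carrier R" "a \<noteq> \<zero>\<^bsub>R\<^esub>"
      show "properly_infinite R a"
      proof (cases "a \<in> I")
        case True
        then show ?thesis
          using ppi a I.properly_infinite_in_ring by (auto simp: properly_purely_infinite_def)
      next
        case False
        then have "I +>\<^bsub>R\<^esub> a \<noteq> \<zero>\<^bsub>R Quot I\<^esub>" using I.rcos_eq_ideal_iff[OF a(1)] by (simp add: FactRing_def)
        moreover have "I +>\<^bsub>R\<^esub> a \<in> carrier (R Quot I)" using a by (auto simp: FactRing_simps)
        ultimately have "properly_infinite (R Quot I) (I +>\<^bsub>R\<^esub> a)"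
          using quot by (auto simp: properly_purely_infinite_def)
        then show ?thesis
          using R.properly_infinite_extension[OF assms(2,3,4) ppi a] by blast
      qed
    qed
  qed
qed

end
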